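(* Let $G=\mathrm{GIRG}(n,\beta,w_0,d)$ be a standard GIRG with any $L_p$-norm, $p\in[1,\infty]$, and let $q_k$ be the probability that a set of $k$ vertices chosen uniformly at random forms a clique. Then $$q_k\ge\begin{cases}\Theta(1)^k\,n^{\frac k2(1-\beta)} & \text{if } k>\frac{2}{3-\beta}\text{ and }2<\beta<3,\\ \Theta(1)^k\,2^{-dk}\,n^{1-k} & \text{otherwise.}\end{cases}$$
   Context: Fix constants $\lambda>0$, $w_0>0$, $\beta>2$. A standard GIRG $\mathrm{GIRG}(n,\beta,w_0,d)$ with $L_p$-norm has $n$ vertices; each vertex $v$ independently receives a weight $w_v$ with $\Pr[w_v\le x]=1-(x/w_0)^{1-\beta}$ for $x\ge w_0$, and independently a position $\mathbf{x}_v$ uniform on the torus $\mathbb{T}^d=[0,1)^d$. Distances are $\|\mathbf{x}_u-\mathbf{x}_v\|_p$ computed from the coordinatewise circle distances $|x_{ui}-x_{vi}|_C=\min\{|x_{ui}-x_{vi}|,1-|x_{ui}-x_{vi}|\}$. Distinct $u,v$ are adjacent iff their distance is at most a threshold $t_{uv}$ chosen such that $\Pr[u\sim v\mid w_u,w_v]=\min\{1,\lambda w_uw_v/n\}$. Notation: $\Theta(1)^k$ denotes a quantity of the form $c^k$ with $c>0$ a constant independent of $n$, $k$, $d$. *)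

theory Defs
  imports "HOL-Probability.Probability"
begin

definition circle_dist :: "real \<Rightarrow> real \<Rightarrow> real" where
  "circle_dist x y = min \<bar>x - y\<bar> (1 - \<bar>x - y\<bar>)"

text \<open>Points of the torus are functions on \<open>{..<d}\<close> with values in \<open>[0,1)\<close>;
  the exponent \<open>p\<close> ranges over the extended reals in \<open>[1,\<infinity>]\<close>.\<close>

definition torus_dist :: "ereal \<Rightarrow> nat \<Rightarrow> (nat \<Rightarrow> real) \<Rightarrow> (nat \<Rightarrow> real) \<Rightarrow> real" where
  "torus_dist p d x y =
     (if p = \<infinity> then Max ((\<lambda>i. circle_dist (x i) (y i)) ` {..<d})
      else (\<Sum>i<d. circle_dist (x i) (y i) powr real_of_ereal p) powr (1 / real_of_ereal p))"

definition torus_measure :: "nat \<Rightarrow> (nat \<Rightarrow> real) measure" where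
  "torus_measure d = Pi\<^sub>M {..<d} (\<lambda>_. restrict_space lborel {0..<1::real})"

text \<open>The probability measure on \<open>[w0,\<infinity>)\<close> with distribution function
  \<open>1 - (x / w0) powr (1 - \<beta>)\<close>. Weights below \<open>w0\<close> and positions outside \<open>[0,1)\<close> are
  removed from the sample space altogether, not merely null: thresholds are
  not assumed measurable, and adjacency need not be measurable there.\<close>

definition weight_measure :: "real \<Rightarrow> real \<Rightarrow> real measure" where
  "weight_measure \<beta> w0 =
     restrict_space
       (interval_measure (\<lambda>x. if x \<ge> w0 then 1 - (x / w0) powr (1 - \<beta>) else 0)) {w0..}"

text \<open>An outcome \<open>\<omega>\<close> assigns to each vertex \<open>v < n\<close> the pair of its weight and its position.\<close>

definition girg_measure :: "nat \<Rightarrow> real \<Rightarrow> real \<Rightarrow> nat \<Rightarrow> (nat \<Rightarrow> real \<times> (nat \<Rightarrow> real)) measure" where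
  "girg_measure n \<beta> w0 d = Pi\<^sub>M {..<n} (\<lambda>_. weight_measure \<beta> w0 \<Otimes>\<^sub>M torus_measure d)"

text \<open>The threshold of a pair of vertices is a function \<open>t\<close> of their weights. As positions are
  independent of weights, the connection probability conditional on the weights \<open>a\<close> and \<open>b\<close> is
  the probability that two independent uniform positions have distance at most \<open>t a b\<close>.\<close>

definition girg_threshold ::
    "real \<Rightarrow> nat \<Rightarrow> real \<Rightarrow> nat \<Rightarrow> ereal \<Rightarrow> (real \<Rightarrow> real \<Rightarrow> real) \<Rightarrow> bool" where
  "girg_threshold lam n w0 d p t \<longleftrightarrow>
     (\<forall>a\<ge>w0. \<forall>b\<ge>w0.
        \<P>(z in torus_measure d \<Otimes>\<^sub>M torus_measure d. torus_dist p d (fst z) (snd z) \<le> t a b)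
          = min 1 (lam * a * b / real n))"

definition girg_adj ::
    "nat \<Rightarrow> ereal \<Rightarrow> (real \<Rightarrow> real \<Rightarrow> real) \<Rightarrow> (nat \<Rightarrow> real \<times> (nat \<Rightarrow> real)) \<Rightarrow> nat \<Rightarrow> nat \<Rightarrow> bool" where
  "girg_adj d p t \<omega> u v \<longleftrightarrow>
     u \<noteq> v \<and> torus_dist p d (snd (\<omega> u)) (snd (\<omega> v)) \<le> t (fst (\<omega> u)) (fst (\<omega> v))"

definition is_clique :: "('v \<Rightarrow> 'v \<Rightarrow> bool) \<Rightarrow> 'v set \<Rightarrow> bool" where
  "is_clique E S \<longleftrightarrow> (\<forall>u\<in>S. \<forall>v\<in>S. u \<noteq> v \<longrightarrow> E u v)"

text \<open>The vertex set is drawn independently of the graph.\<close>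

definition clique_prob ::
    "nat \<Rightarrow> real \<Rightarrow> real \<Rightarrow> nat \<Rightarrow> ereal \<Rightarrow> (real \<Rightarrow> real \<Rightarrow> real) \<Rightarrow> nat \<Rightarrow> real" where
  "clique_prob n \<beta> w0 d p t k =
     \<P>(z in girg_measure n \<beta> w0 d \<Otimes>\<^sub>M uniform_count_measure {S. S \<subseteq> {..<n} \<and> card S = k}.
        is_clique (girg_adj d p t (fst z)) (snd z))"

end

theory Submission
  imports Defs
begin

text \<open>Two kinds of cliques give the two bounds. First, vertices
  of weight at least \<open>sqrt (n / lam)\<close> are pairwise adjacent with certainty, and each vertex is that
  heavy with probability of order \<open>n powr ((1 - \<beta>) / 2)\<close>. Second, all thresholds are at least
  \<open>r = t w0 w0\<close>, so \<open>k\<close> vertices form a clique if \<open>k - 1\<close> of them lie within distance \<open>r / 2\<close>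
  of the remaining one. The coordinatewise circle distances from a fixed point to a uniform point
  are independent and uniform on \<open>[0, 1/2]\<close>; shrinking this cube by a factor 2 shows that the
  ball of radius \<open>r / 2\<close> has at least \<open>1 / 2 ^ d\<close> times the volume \<open>min 1 (lam * w0 * w0 / n)\<close>
  of the ball of radius \<open>r\<close>, even if the latter wraps around the torus.\<close>

section \<open>\<open>L\<^sub>p\<close>-norms and circle distances\<close>

text \<open>Coordinates enter without absolute values, so this is the usual norm on nonnegative
  vectors. It is split off from \<open>torus_dist\<close> so that it also applies to random vectors
  of coordinatewise distances.\<close>

definition lp_norm :: "ereal \<Rightarrow> nat \<Rightarrow> (nat \<Rightarrow> real) \<Rightarrow> real" where
  "lp_norm p d c =
     (if p = \<infinity> then Max (c ` {..<d})
      else (\<Sum>i<d. c i powr real_of_ereal p) powr (1 / real_of_ereal p))"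

lemma torus_dist_eq_lp_norm: "torus_dist p d x y = lp_norm p d (\<lambda>i. circle_dist (x i) (y i))"
  by (simp add: torus_dist_def lp_norm_def)

lemma real_of_ereal_ge_1:
  fixes p :: ereal
  assumes "1 \<le> p" "p \<noteq> \<infinity>"
  shows "1 \<le> real_of_ereal p"
  using assms by (cases p) (auto simp: one_ereal_def)

lemma lp_norm_cong: "(\<And>i. i < d \<Longrightarrow> a i = b i) \<Longrightarrow> lp_norm p d a = lp_norm p d b"
  by (auto simp: lp_norm_def intro!: arg_cong[where f=Max] image_cong arg_cong2[where f="(powr)"] sum.cong)

lemma lp_norm_mono:
  assumes "1 \<le> p" "1 \<le> d" and le: "\<And>i. i < d \<Longrightarrow> 0 \<le> a i \<and> a i \<le> b i"
  shows "lp_norm p d a \<le> lp_norm p d b"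
proof (cases "p = \<infinity>")
  case True
  have "{..<d} \<noteq> {}" using \<open>1 \<le> d\<close> by (auto simp: lessThan_empty_iff)
  have "a i \<le> Max (b ` {..<d})" if "i < d" for i
    using le[OF that] that by (intro order.trans[OF _ Max_ge]) auto
  with \<open>{..<d} \<noteq> {}\<close> True show ?thesis
    by (auto simp: lp_norm_def Max_le_iff)
next
  case False
  with real_of_ereal_ge_1[OF \<open>1 \<le> p\<close>] have "1 \<le> real_of_ereal p" by simp
  with False le show ?thesis
    by (auto simp: lp_norm_def intro!: powr_mono2 sum_mono sum_nonneg)
qed

lemma lp_norm_nonneg:
  assumes "1 \<le> d" and nonneg: "\<And>i. i < d \<Longrightarrow> 0 \<le> a i"
  shows "0 \<le> lp_norm p d a"
proof (cases "p = \<infinity>")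
  case True
  have "0 \<le> a 0" using assms by auto
  also have "a 0 \<le> Max (a ` {..<d})" using \<open>1 \<le> d\<close> by (intro Max_ge) auto
  finally show ?thesis using True by (simp add: lp_norm_def)
qed (simp add: lp_norm_def)

lemma lp_norm_scale:
  assumes "1 \<le> p" "1 \<le> d" "0 \<le> s" and nonneg: "\<And>i. i < d \<Longrightarrow> 0 \<le> a i"
  shows "lp_norm p d (\<lambda>i. s * a i) = s * lp_norm p d a"
proof (cases "p = \<infinity>")
  case True
  have "mono ((*) s)" using \<open>0 \<le> s\<close> by (auto intro!: monoI mult_left_mono)
  moreover have "a ` {..<d} \<noteq> {}" using \<open>1 \<le> d\<close> by (auto simp: lessThan_empty_iff)
  ultimately have "s * Max (a ` {..<d}) = Max ((*) s ` a ` {..<d})"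
    by (intro mono_Max_commute) auto
  with True show ?thesis by (simp add: lp_norm_def image_image)
next
  case False
  let ?q = "real_of_ereal p"
  have q: "1 \<le> ?q" using real_of_ereal_ge_1[OF \<open>1 \<le> p\<close>] False by simp
  have "(\<Sum>i<d. (s * a i) powr ?q) = s powr ?q * (\<Sum>i<d. a i powr ?q)"
    using assms by (simp add: powr_mult sum_distrib_left)
  moreover have "(s powr ?q) powr (1 / ?q) = s"
    using q \<open>0 \<le> s\<close> by (simp add: powr_powr)
  ultimately show ?thesis
    using False by (simp add: lp_norm_def powr_mult sum_nonneg)
qed

text \<open>Convexity of \<open>x powr q\<close> at the midpoint of \<open>a\<close> and
  \<open>b\<close>, multiplied by \<open>2 powr q\<close>. If \<open>a\<close> or \<open>b\<close>
  is 0, it is enough that the factor \<open>2 powr (q - 1)\<close> is at least 1.\<close>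

lemma powr_add_le:
  fixes a b q :: real
  assumes "1 \<le> q" "0 \<le> a" "0 \<le> b"
  shows "(a + b) powr q \<le> 2 powr (q - 1) * (a powr q + b powr q)"
proof -
  have one: "1 \<le> (2::real) powr (q - 1)" using assms by (intro ge_one_powr_ge_zero) auto
  consider "a = 0" | "b = 0" | "0 < a" "0 < b" using assms by linarith
  then show ?thesis
  proof cases
    case 3
    have "((1 - 1/2) *\<^sub>R a + (1/2) *\<^sub>R b) powr q \<le> (1 - 1/2) * a powr q + 1/2 * b powr q"
      using powr_convex[OF \<open>1 \<le> q\<close>] 3 by (intro convex_onD) auto
    then have "((a + b) / 2) powr q \<le> (a powr q + b powr q) / 2" by (simp add: field_simps)
    then show ?thesis
      using 3 by (simp add: powr_divide powr_diff field_simps)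
  qed (use one mult_right_mono[OF one, of "a powr q"] mult_right_mono[OF one, of "b powr q"] in auto)
qed

text \<open>Midpoint convexity is all that is needed of the triangle inequality.\<close>

lemma lp_norm_le_double:
  assumes "1 \<le> p" "1 \<le> d"
    and nonneg: "\<And>i. i < d \<Longrightarrow> 0 \<le> a i \<and> 0 \<le> b i \<and> 0 \<le> e i"
    and le: "\<And>i. i < d \<Longrightarrow> e i \<le> a i + b i"
    and a: "lp_norm p d a \<le> r" and b: "lp_norm p d b \<le> r"
  shows "lp_norm p d e \<le> 2 * r"
proof (cases "p = \<infinity>")
  case True
  have ne: "{..<d} \<noteq> {}" using \<open>1 \<le> d\<close> by (auto simp: lessThan_empty_iff)
  have "\<forall>i<d. a i \<le> r" "\<forall>i<d. b i \<le> r"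
    using a b True ne by (auto simp: lp_norm_def)
  with le have "\<forall>i<d. e i \<le> 2 * r" by (metis add_mono mult_2 order.trans)
  with True ne show ?thesis by (auto simp: lp_norm_def)
next
  case False
  let ?q = "real_of_ereal p"
  have q: "1 \<le> ?q" using real_of_ereal_ge_1[OF \<open>1 \<le> p\<close>] False by simp
  \<comment> \<open>Forced by the bound on the norm of \<open>a\<close>. It is used when the
    exponents \<open>q\<close> and \<open>1 / q\<close> on \<open>2 * r\<close> are cancelled at the
    end.\<close>
  have r: "0 \<le> r" using lp_norm_nonneg[OF \<open>1 \<le> d\<close>, of a p] nonneg a by force
  have sum_le: "(\<Sum>i<d. c i powr ?q) \<le> r powr ?q" if "lp_norm p d c \<le> r" for c
  proof -
    have "((\<Sum>i<d. c i powr ?q) powr (1 / ?q)) powr ?q \<le> r powr ?q"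
      using that q False by (intro powr_mono2) (auto simp: lp_norm_def)
    then show ?thesis using q by (simp add: powr_powr sum_nonneg)
  qed
  have "(\<Sum>i<d. e i powr ?q) \<le> (\<Sum>i<d. 2 powr (?q - 1) * (a i powr ?q + b i powr ?q))"
  proof (rule sum_mono)
    fix i assume "i \<in> {..<d}"
    then have i: "0 \<le> a i" "0 \<le> b i" "0 \<le> e i" "e i \<le> a i + b i" using nonneg le by auto
    have "e i powr ?q \<le> (a i + b i) powr ?q" using i q by (intro powr_mono2) auto
    also have "\<dots> \<le> 2 powr (?q - 1) * (a i powr ?q + b i powr ?q)"
      using i q by (intro powr_add_le)
    finally show "e i powr ?q \<le> 2 powr (?q - 1) * (a i powr ?q + b i powr ?q)" .
  qed
  also have "\<dots> = 2 powr (?q - 1) * ((\<Sum>i<d. a i powr ?q) + (\<Sum>i<d. b i powr ?q))"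
    by (simp add: sum.distrib flip: sum_distrib_left)
  also have "\<dots> \<le> 2 powr (?q - 1) * (r powr ?q + r powr ?q)"
    using sum_le[OF a] sum_le[OF b] by (intro mult_left_mono add_mono) auto
  \<comment> \<open>The factor \<open>2 powr (q - 1)\<close> and the two equal summands combine to
    \<open>2 powr q\<close>, so the constant is exactly 2 for every \<open>p\<close>.\<close>
  also have "\<dots> = (2 * r) powr ?q" using r by (simp add: powr_diff powr_mult)
  finally have "(\<Sum>i<d. e i powr ?q) powr (1 / ?q) \<le> ((2 * r) powr ?q) powr (1 / ?q)"
    using q by (intro powr_mono2) (auto simp: sum_nonneg)
  then show ?thesis using False r q by (simp add: lp_norm_def powr_powr)
qed

lemma lp_norm_measurable [measurable]:
  assumes "\<And>i. i < d \<Longrightarrow> (\<lambda>x. f x i) \<in> borel_measurable M"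
  shows "(\<lambda>x. lp_norm p d (f x)) \<in> borel_measurable M"
proof (cases "p = \<infinity>")
  case True
  then show ?thesis using assms unfolding lp_norm_def by (auto intro!: borel_measurable_Max)
next
  case False
  have [measurable]: "(\<lambda>x. (\<Sum>i<d. f x i powr real_of_ereal p)) \<in> borel_measurable M"
    using assms by (intro borel_measurable_sum powr_real_measurable) auto
  then show ?thesis using False unfolding lp_norm_def by simp
qed

section \<open>Circle distances and their law for a uniform point\<close>

lemma circle_dist_nonneg: "x \<in> {0..<1} \<Longrightarrow> y \<in> {0..<1} \<Longrightarrow> 0 \<le> circle_dist x y"
  by (auto simp: circle_dist_def)

lemma circle_dist_le_half: "circle_dist x y \<le> 1 / 2"
  by (auto simp: circle_dist_def min_def)

lemma circle_dist_commute: "circle_dist x y = circle_dist y x"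
  by (simp add: circle_dist_def abs_minus_commute)

lemma circle_dist_triangle:
  "x \<in> {0..<1} \<Longrightarrow> y \<in> {0..<1} \<Longrightarrow> z \<in> {0..<1} \<Longrightarrow> circle_dist x z \<le> circle_dist x y + circle_dist y z"
  by (auto simp: circle_dist_def min_def abs_if)

lemma circle_dist_measurable [measurable]:
  "f \<in> borel_measurable M \<Longrightarrow> g \<in> borel_measurable M \<Longrightarrow> (\<lambda>x. circle_dist (f x) (g x)) \<in> borel_measurable M"
  unfolding circle_dist_def
  by (intro borel_measurable_min borel_measurable_abs borel_measurable_diff) auto

text \<open>The law of the circle distance from a fixed point to a uniform point, as
  \<open>nn_integral_circle_dist\<close> shows.\<close>

abbreviation half_unif :: "real measure" where
  "half_unif \<equiv> uniform_measure lborel {0..1/2}"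

text \<open>Reduces a base point above 1/2 to one below 1/2.\<close>

lemma circle_dist_reflect: "circle_dist x y = circle_dist (1 - x) (1 - y)"
  by (simp add: circle_dist_def abs_minus_commute)

text \<open>Cut the circle into the arcs \<open>y \<le> x\<close>,
  \<open>x < y \<le> x + 1/2\<close> and \<open>y > x + 1/2\<close>, where the distance is
  \<open>x - y\<close>, \<open>y - x\<close> and \<open>1 + x - y\<close>. The middle arc covers the
  distances up to 1/2 once, and the two outer arcs together cover them once more; hence the factor
  2.\<close>

lemma nn_integral_circle_dist_aux:
  fixes h :: "real \<Rightarrow> ennreal"
  assumes [measurable]: "h \<in> borel_measurable borel" and x: "0 \<le> x" "x \<le> 1 / 2"
  shows "(\<integral>\<^sup>+y. h (circle_dist x y) * indicator {0..1} y \<partial>lborel) = 2 * (\<integral>\<^sup>+c. h c * indicator {0..1/2} c \<partial>lborel)"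
proof -
  have "(\<integral>\<^sup>+y. h (circle_dist x y) * indicator {0..1} y \<partial>lborel)
     = (\<integral>\<^sup>+y. h (x - y) * indicator {0..x} (x - y) + h (y - x) * indicator {0<..1/2} (y - x)
          + h (1 + x - y) * indicator {x..<1/2} (1 + x - y) \<partial>lborel)"
    using x by (intro nn_integral_cong) (auto simp: circle_dist_def min_def indicator_def algebra_simps)
  also have "\<dots> = (\<integral>\<^sup>+y. h (x - y) * indicator {0..x} (x - y) \<partial>lborel)
      + (\<integral>\<^sup>+y. h (y - x) * indicator {0<..1/2} (y - x) \<partial>lborel)
      + (\<integral>\<^sup>+y. h (1 + x - y) * indicator {x..<1/2} (1 + x - y) \<partial>lborel)"
    by (simp add: nn_integral_add)
  also have "(\<integral>\<^sup>+y. h (x - y) * indicator {0..x} (x - y) \<partial>lborel) = (\<integral>\<^sup>+c. h c * indicator {0..x} c \<partial>lborel)"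
    by (subst nn_integral_real_affine[where c="-1" and t=x]) auto
  also have "(\<integral>\<^sup>+y. h (y - x) * indicator {0<..1/2} (y - x) \<partial>lborel) = (\<integral>\<^sup>+c. h c * indicator {0<..1/2} c \<partial>lborel)"
    by (subst nn_integral_real_affine[where c="1" and t=x]) auto
  also have "(\<integral>\<^sup>+y. h (1 + x - y) * indicator {x..<1/2} (1 + x - y) \<partial>lborel) = (\<integral>\<^sup>+c. h c * indicator {x..<1/2} c \<partial>lborel)"
    by (subst nn_integral_real_affine[where c="-1" and t="1 + x"]) auto
  also have "(\<integral>\<^sup>+c. h c * indicator {0..x} c \<partial>lborel) + (\<integral>\<^sup>+c. h c * indicator {0<..1/2} c \<partial>lborel)
        + (\<integral>\<^sup>+c. h c * indicator {x..<1/2} c \<partial>lborel)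
      = (\<integral>\<^sup>+c. h c * indicator {0..x} c + h c * indicator {0<..1/2} c + h c * indicator {x..<1/2} c \<partial>lborel)"
    by (simp add: nn_integral_add)
  also have "\<dots> = (\<integral>\<^sup>+c. 2 * (h c * indicator {0..1/2} c) \<partial>lborel)"
  proof (rule nn_integral_cong_AE)
    \<comment> \<open>The three intervals cover \<open>{0..1/2}\<close> exactly twice away from
      these points.\<close>
    have "AE c in lborel. c \<noteq> 0" "AE c in lborel. c \<noteq> x" "AE c in lborel. c \<noteq> 1/2"
      by (rule AE_lborel_singleton)+
    then show "AE c in lborel. h c * indicator {0..x} c + h c * indicator {0<..1/2} c + h c * indicator {x..<1/2} c
        = 2 * (h c * indicator {0..1/2} c)"
      by eventually_elim (use x in \<open>auto simp: indicator_def mult_2\<close>)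
  qed
  finally show ?thesis by (simp add: nn_integral_cmult)
qed

lemma nn_integral_half_unif:
  fixes h :: "real \<Rightarrow> ennreal"
  assumes [measurable]: "h \<in> borel_measurable borel"
  shows "(\<integral>\<^sup>+c. h c \<partial>half_unif) = 2 * (\<integral>\<^sup>+c. h c * indicator {0..1/2} c \<partial>lborel)"
proof -
  have "inverse (ennreal (1 / 2)) = ennreal 2" by (subst inverse_ennreal) auto
  then have "inverse (emeasure lborel {0..1/2::real}) = 2" by simp
  then show ?thesis
    by (subst nn_integral_uniform_measure) (auto simp: divide_ennreal_def mult.commute)
qed

lemma nn_integral_circle_dist:
  fixes h :: "real \<Rightarrow> ennreal"
  assumes [measurable]: "h \<in> borel_measurable borel" and x: "x \<in> {0..<1}"
  shows "(\<integral>\<^sup>+y. h (circle_dist x y) \<partial>restrict_space lborel {0..<1}) = (\<integral>\<^sup>+c. h c \<partial>half_unif)"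
proof -
  have "(\<integral>\<^sup>+y. h (circle_dist x y) * indicator {0..1} y \<partial>lborel) = 2 * (\<integral>\<^sup>+c. h c * indicator {0..1/2} c \<partial>lborel)"
  proof (cases "x \<le> 1 / 2")
    case False
    \<comment> \<open>Replacing \<open>y\<close> by \<open>1 - y\<close> preserves
      \<open>{0..1}\<close> but not \<open>{0..<1}\<close>. Hence the closed interval here; the
      point 1 is discarded below as a null set.\<close>
    have "(\<integral>\<^sup>+y. h (circle_dist x y) * indicator {0..1} y \<partial>lborel)
        = (\<integral>\<^sup>+y. h (circle_dist x (1 - y)) * indicator {0..1} (1 - y) \<partial>lborel)"
      by (subst nn_integral_real_affine[where c="-1" and t="1"]) auto
    also have "\<dots> = (\<integral>\<^sup>+y. h (circle_dist (1 - x) y) * indicator {0..1} y \<partial>lborel)"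
      by (intro nn_integral_cong) (auto simp: indicator_def circle_dist_reflect[of x])
    finally show ?thesis using False x nn_integral_circle_dist_aux[of h "1 - x"] by simp
  qed (use x nn_integral_circle_dist_aux[of h x] in simp)
  moreover have "(\<integral>\<^sup>+y. h (circle_dist x y) \<partial>restrict_space lborel {0..<1})
      = (\<integral>\<^sup>+y. h (circle_dist x y) * indicator {0..1} y \<partial>lborel)"
  proof (subst nn_integral_restrict_space)
    show "(\<integral>\<^sup>+y. h (circle_dist x y) * indicator {0..<1} y \<partial>lborel)
        = (\<integral>\<^sup>+y. h (circle_dist x y) * indicator {0..1} y \<partial>lborel)"
      by (rule nn_integral_cong_AE, use AE_lborel_singleton[of 1] in eventually_elim)
        (auto simp: indicator_def)
  qed simp
  moreover have "(\<integral>\<^sup>+c. h c \<partial>half_unif) = 2 * (\<integral>\<^sup>+c. h c * indicator {0..1/2} c \<partial>lborel)"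
    by (rule nn_integral_half_unif) simp
  ultimately show ?thesis by simp
qed

section \<open>Volumes of balls in the torus\<close>

lemma prob_space_half_unif: "prob_space half_unif"
  by (rule prob_space_uniform_measure) auto

lemma prob_space_unit_interval: "prob_space (restrict_space lborel {0..<1::real})"
  by (rule prob_spaceI) (simp add: emeasure_restrict_space space_restrict_space)

lemma prob_space_torus_measure: "prob_space (torus_measure d)"
  unfolding torus_measure_def by (intro prob_space_PiM prob_space_unit_interval)

lemma space_torus_measure: "space (torus_measure d) = (\<Pi>\<^sub>E i\<in>{..<d}. {0..<1})"
  by (simp add: torus_measure_def space_PiM space_restrict_space)

lemma torus_component_measurable [measurable]:
  "i < d \<Longrightarrow> (\<lambda>x. x i) \<in> borel_measurable (torus_measure d)"
  unfolding torus_measure_def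
  by (rule measurable_compose[OF measurable_component_singleton])
     (auto intro: measurable_restrict_space1)

lemma circle_dist_measurable_unit [measurable]:
  "circle_dist x \<in> measurable (restrict_space lborel {0..<1}) half_unif"
proof -
  have "circle_dist x \<in> borel_measurable borel" by measurable
  then show ?thesis
    by (auto simp: measurable_cong_sets[OF refl sets_uniform_measure] intro: measurable_restrict_space1)
qed

lemma distr_circle_dist:
  assumes "x \<in> {0..<1}"
  shows "distr (restrict_space lborel {0..<1}) half_unif (circle_dist x) = half_unif"
proof (rule measure_eqI)
  fix A assume "A \<in> sets (distr (restrict_space lborel {0..<1}) half_unif (circle_dist x))"
  then have A[measurable]: "A \<in> sets borel" by simp
  have "emeasure (distr (restrict_space lborel {0..<1}) half_unif (circle_dist x)) A
      = (\<integral>\<^sup>+c. indicator A c \<partial>distr (restrict_space lborel {0..<1}) half_unif (circle_dist x))"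
    by simp
  also have "\<dots> = (\<integral>\<^sup>+y. indicator A (circle_dist x y) \<partial>restrict_space lborel {0..<1})"
    by (rule nn_integral_distr) (auto intro!: borel_measurable_indicator)
  also have "\<dots> = (\<integral>\<^sup>+c. indicator A c \<partial>half_unif)"
    using assms by (intro nn_integral_circle_dist) auto
  finally show "emeasure (distr (restrict_space lborel {0..<1}) half_unif (circle_dist x)) A = emeasure half_unif A"
    by simp
qed simp

text \<open>The index set is left general for the induction over coordinates in
  \<open>nn_integral_half_cube_double\<close>.\<close>

definition half_cube :: "nat set \<Rightarrow> (nat \<Rightarrow> real) measure" where
  "half_cube I = Pi\<^sub>M I (\<lambda>_. half_unif)"

lemma prob_space_half_cube: "prob_space (half_cube I)"
  unfolding half_cube_def by (intro prob_space_PiM prob_space_half_unif)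

lemma half_cube_component_measurable [measurable]:
  "i \<in> I \<Longrightarrow> (\<lambda>x. x i) \<in> borel_measurable (half_cube I)"
  unfolding half_cube_def
  by (rule measurable_compose[OF measurable_component_singleton]) (auto simp: measurable_ident_sets)

text \<open>It suffices to compare boxes, since the target is a product measure. The preimage of a
  box is again a box, and \<open>distr_circle_dist\<close> handles each factor.\<close>

lemma distr_torus_circle_dist:
  assumes x: "x \<in> space (torus_measure d)"
  shows "(\<lambda>y. \<lambda>i\<in>{..<d}. circle_dist (x i) (y i)) \<in> measurable (torus_measure d) (half_cube {..<d})" (is "?f \<in> _")
    and "distr (torus_measure d) (half_cube {..<d}) (\<lambda>y. \<lambda>i\<in>{..<d}. circle_dist (x i) (y i)) = half_cube {..<d}"
proof -
  let ?L = "restrict_space lborel {0..<1::real}"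
  have f: "?f \<in> measurable (Pi\<^sub>M {..<d} (\<lambda>_. ?L)) (Pi\<^sub>M {..<d} (\<lambda>_. half_unif))"
    by (intro measurable_restrict measurable_compose[OF measurable_component_singleton]) auto
  then show "?f \<in> measurable (torus_measure d) (half_cube {..<d})"
    by (simp add: torus_measure_def half_cube_def)
  interpret H: product_prob_space "\<lambda>_::nat. half_unif" by (simp add: product_prob_spaceI prob_space_half_unif)
  interpret L: product_prob_space "\<lambda>_::nat. ?L" by (simp add: product_prob_spaceI prob_space_unit_interval)
  show "distr (torus_measure d) (half_cube {..<d}) ?f = half_cube {..<d}"
    unfolding torus_measure_def half_cube_def
  proof (rule H.PiM_eqI)
    fix A :: "nat \<Rightarrow> real set" assume A: "\<And>i. i \<in> {..<d} \<Longrightarrow> A i \<in> sets half_unif"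
    have "?f -` Pi\<^sub>E {..<d} A \<inter> space (Pi\<^sub>M {..<d} (\<lambda>_. ?L))
        = (\<Pi>\<^sub>E i\<in>{..<d}. circle_dist (x i) -` A i \<inter> space ?L)"
      by (auto simp: space_PiM PiE_iff)
    moreover have "Pi\<^sub>E {..<d} A \<in> sets (Pi\<^sub>M {..<d} (\<lambda>_. half_unif))"
      using A by (intro sets_PiM_I_finite) auto
    ultimately have "emeasure (distr (Pi\<^sub>M {..<d} (\<lambda>_. ?L)) (Pi\<^sub>M {..<d} (\<lambda>_. half_unif)) ?f) (Pi\<^sub>E {..<d} A)
        = emeasure (Pi\<^sub>M {..<d} (\<lambda>_. ?L)) (\<Pi>\<^sub>E i\<in>{..<d}. circle_dist (x i) -` A i \<inter> space ?L)"
      by (simp add: emeasure_distr[OF f])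
    also have "\<dots> = (\<Prod>i<d. emeasure ?L (circle_dist (x i) -` A i \<inter> space ?L))"
      using A by (intro L.emeasure_PiM measurable_sets[OF circle_dist_measurable_unit]) auto
    also have "\<dots> = (\<Prod>i<d. emeasure half_unif (A i))"
    proof (rule prod.cong)
      fix i assume i: "i \<in> {..<d}"
      then have "x i \<in> {0..<1}" using x by (auto simp: space_torus_measure PiE_iff)
      then have "emeasure half_unif (A i) = emeasure (distr ?L half_unif (circle_dist (x i))) (A i)"
        by (simp add: distr_circle_dist)
      also have "\<dots> = emeasure ?L (circle_dist (x i) -` A i \<inter> space ?L)"
        using A[OF i] by (intro emeasure_distr) auto
      finally show "emeasure ?L (circle_dist (x i) -` A i \<inter> space ?L) = emeasure half_unif (A i)" ..
    qed simp
    finally show "emeasure (distr (Pi\<^sub>M {..<d} (\<lambda>_. ?L)) (Pi\<^sub>M {..<d} (\<lambda>_. half_unif)) ?f) (Pi\<^sub>E {..<d} A)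
        = (\<Prod>i<d. emeasure half_unif (A i))" .
  qed auto
qed

text \<open>The ball is measured through the vector of distances to its centre. The centre thereby
  disappears, and wrapping around the torus needs no separate treatment.\<close>

definition ball_vol :: "ereal \<Rightarrow> nat \<Rightarrow> real \<Rightarrow> real" where
  "ball_vol p d r = measure (half_cube {..<d}) {c \<in> space (half_cube {..<d}). lp_norm p d c \<le> r}"

lemma ball_measurable [measurable]:
  "{c \<in> space (half_cube {..<d}). lp_norm p d c \<le> r} \<in> sets (half_cube {..<d})"
proof -
  have [measurable]: "lp_norm p d \<in> borel_measurable (half_cube {..<d})"
    using lp_norm_measurable[of d "\<lambda>x. x" "half_cube {..<d}" p] by simp
  show ?thesis by measurable
qed

text \<open>The ball is the preimage of a norm ball under the map to coordinatewise distances, and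
  the law of these distances does not depend on the centre.\<close>

lemma emeasure_torus_ball:
  assumes x: "x \<in> space (torus_measure d)"
  shows "emeasure (torus_measure d) {y \<in> space (torus_measure d). torus_dist p d x y \<le> r} = ball_vol p d r"
proof -
  interpret prob_space "half_cube {..<d}" by (rule prob_space_half_cube)
  let ?f = "\<lambda>y. \<lambda>i\<in>{..<d}. circle_dist (x i) (y i)"
  let ?B = "{c \<in> space (half_cube {..<d}). lp_norm p d c \<le> r}"
  note f = distr_torus_circle_dist[OF x]
  have "?f -` ?B \<inter> space (torus_measure d) = {y \<in> space (torus_measure d). torus_dist p d x y \<le> r}"
    using measurable_space[OF f(1)]
    by (auto simp: torus_dist_eq_lp_norm cong: lp_norm_cong)
  then have "emeasure (distr (torus_measure d) (half_cube {..<d}) ?f) ?B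
      = emeasure (torus_measure d) {y \<in> space (torus_measure d). torus_dist p d x y \<le> r}"
    by (simp add: emeasure_distr[OF f(1)])
  then show ?thesis by (simp add: f(2) emeasure_eq_measure ball_vol_def)
qed

lemma torus_dist_measurable [measurable]:
  assumes "f \<in> measurable M (torus_measure d)" "g \<in> measurable M (torus_measure d)"
  shows "(\<lambda>z. torus_dist p d (f z) (g z)) \<in> borel_measurable M"
  unfolding torus_dist_eq_lp_norm
  by (intro lp_norm_measurable circle_dist_measurable
        measurable_compose[OF assms(1)] measurable_compose[OF assms(2)] torus_component_measurable)

text \<open>Fubini: the inner probability is the same for every position of the first point. This
  turns the condition on thresholds into one on ball volumes.\<close>

lemma prob_torus_dist_le:
  "\<P>(z in torus_measure d \<Otimes>\<^sub>M torus_measure d. torus_dist p d (fst z) (snd z) \<le> r) = ball_vol p d r"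
proof -
  interpret T: prob_space "torus_measure d" by (rule prob_space_torus_measure)
  interpret TT: pair_prob_space "torus_measure d" "torus_measure d" ..
  let ?A = "{z \<in> space (torus_measure d \<Otimes>\<^sub>M torus_measure d). torus_dist p d (fst z) (snd z) \<le> r}"
  have "?A \<in> sets (torus_measure d \<Otimes>\<^sub>M torus_measure d)" by measurable
  then have "emeasure (torus_measure d \<Otimes>\<^sub>M torus_measure d) ?A
      = (\<integral>\<^sup>+x. emeasure (torus_measure d) (Pair x -` ?A) \<partial>torus_measure d)"
    by (rule T.emeasure_pair_measure_alt)
  also have "\<dots> = (\<integral>\<^sup>+x. ball_vol p d r \<partial>torus_measure d)"
  proof (rule nn_integral_cong)
    fix x assume x: "x \<in> space (torus_measure d)"
    then have "Pair x -` ?A = {y \<in> space (torus_measure d). torus_dist p d x y \<le> r}"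
      by (auto simp: space_pair_measure)
    then show "emeasure (torus_measure d) (Pair x -` ?A) = ball_vol p d r"
      using emeasure_torus_ball[OF x] by simp
  qed
  also have "\<dots> = ball_vol p d r" by (simp add: T.emeasure_space_1)
  finally show ?thesis by (simp add: measure_def ball_vol_def)
qed

text \<open>Substituting \<open>2 * c\<close> gives the factor 2 and confines \<open>c\<close> to
  \<open>{0..1/4}\<close>; enlarging this interval to \<open>{0..1/2}\<close> gives the
  inequality.\<close>

lemma nn_integral_half_unif_double:
  fixes g :: "real \<Rightarrow> ennreal"
  assumes [measurable]: "g \<in> borel_measurable borel"
  shows "(\<integral>\<^sup>+c. g c \<partial>half_unif) \<le> 2 * (\<integral>\<^sup>+c. g (2 * c) \<partial>half_unif)"
proof -
  have "(\<integral>\<^sup>+c. g c \<partial>half_unif) = 2 * (\<integral>\<^sup>+c. g c * indicator {0..1/2} c \<partial>lborel)"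
    by (rule nn_integral_half_unif) simp
  also have "(\<integral>\<^sup>+c. g c * indicator {0..1/2} c \<partial>lborel) = 2 * (\<integral>\<^sup>+c. g (2 * c) * indicator {0..1/2} (2 * c) \<partial>lborel)"
    by (subst nn_integral_real_affine[where c=2 and t=0]) auto
  also have "(\<integral>\<^sup>+c. g (2 * c) * indicator {0..1/2} (2 * c) \<partial>lborel) \<le> (\<integral>\<^sup>+c. g (2 * c) * indicator {0..1/2} c \<partial>lborel)"
    by (intro nn_integral_mono) (auto simp: indicator_def)
  also have "2 * (2 * (\<integral>\<^sup>+c. g (2 * c) * indicator {0..1/2} c \<partial>lborel)) = 2 * (\<integral>\<^sup>+c. g (2 * c) \<partial>half_unif)"
    by (subst nn_integral_half_unif) auto
  finally show ?thesis by (simp add: mult_left_mono)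
qed

text \<open>Induction over the coordinates by Fubini: the one-dimensional bound doubles the new
  coordinate, the induction hypothesis the others.\<close>

lemma nn_integral_half_cube_double:
  fixes f :: "(nat \<Rightarrow> real) \<Rightarrow> ennreal"
  assumes "finite I" "f \<in> borel_measurable (half_cube I)"
  shows "(\<integral>\<^sup>+c. f c \<partial>half_cube I) \<le> 2 ^ card I * (\<integral>\<^sup>+c. f (\<lambda>i\<in>I. 2 * c i) \<partial>half_cube I)"
  using assms
proof (induction I arbitrary: f rule: finite_induct)
  case empty
  then show ?case by (simp add: half_cube_def PiM_empty nn_integral_count_space_finite restrict_def)
next
  case (insert i I)
  interpret H: product_prob_space "\<lambda>_::nat. half_unif" by (simp add: product_prob_spaceI prob_space_half_unif)
  note [measurable] = insert.prems
  have upd: "(\<lambda>(c, y). c(i := y)) \<in> measurable (half_cube I \<Otimes>\<^sub>M half_unif) (half_cube (insert i I))"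
    unfolding half_cube_def by measurable
  have dbl: "(\<lambda>c. \<lambda>j\<in>J. 2 * c j) \<in> measurable (half_cube J) (half_cube J)" for J
    unfolding half_cube_def by measurable
  have d1: "(\<lambda>y. 2 * y) \<in> measurable half_unif half_unif" by simp
  have F[measurable]: "(\<lambda>(c, y). f (c(i := y))) \<in> borel_measurable (half_cube I \<Otimes>\<^sub>M half_unif)"
    using measurable_compose[OF upd insert.prems] by (simp add: case_prod_beta' fun_upd_def)
  have F2: "(\<lambda>(c, y). f (c(i := 2 * y))) \<in> borel_measurable (half_cube I \<Otimes>\<^sub>M half_unif)"
  proof -
    have "(\<lambda>z. (fst z, 2 * snd z)) \<in> measurable (half_cube I \<Otimes>\<^sub>M half_unif) (half_cube I \<Otimes>\<^sub>M half_unif)"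
      by (intro measurable_Pair measurable_fst measurable_compose[OF measurable_snd d1])
    from measurable_compose[OF this F] show ?thesis by (simp add: case_prod_beta')
  qed
  have "(\<integral>\<^sup>+c. f c \<partial>half_cube (insert i I)) = (\<integral>\<^sup>+c. (\<integral>\<^sup>+y. f (c(i := y)) \<partial>half_unif) \<partial>half_cube I)"
    using H.product_nn_integral_insert[OF insert.hyps, of f] insert.prems by (simp add: half_cube_def)
  also have "\<dots> \<le> (\<integral>\<^sup>+c. 2 * (\<integral>\<^sup>+y. f (c(i := 2 * y)) \<partial>half_unif) \<partial>half_cube I)"
  proof (intro nn_integral_mono nn_integral_half_unif_double)
    fix c assume "c \<in> space (half_cube I)"
    then have "(\<lambda>y. f (c(i := y))) \<in> borel_measurable half_unif"
      using measurable_compose[OF measurable_Pair1' F] by simp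
    then show "(\<lambda>y. f (c(i := y))) \<in> borel_measurable borel" by simp
  qed
  \<comment> \<open>The induction hypothesis is applied to the function from which coordinate
    \<open>i\<close> is already integrated out; this is why \<open>f\<close> is generalised.\<close>
  also have "\<dots> \<le> 2 ^ card I * (\<integral>\<^sup>+c. 2 * (\<integral>\<^sup>+y. f ((\<lambda>j\<in>I. 2 * c j)(i := 2 * y)) \<partial>half_unif) \<partial>half_cube I)"
    by (intro insert.IH borel_measurable_times_ennreal borel_measurable_const H.M.borel_measurable_nn_integral F2)
  also have "\<dots> = 2 ^ card I * (2 * (\<integral>\<^sup>+c. (\<integral>\<^sup>+y. f ((\<lambda>j\<in>I. 2 * c j)(i := 2 * y)) \<partial>half_unif) \<partial>half_cube I))"
    using measurable_compose[OF dbl H.M.borel_measurable_nn_integral[OF F2]]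
    by (subst nn_integral_cmult) auto
  also have "(\<integral>\<^sup>+c. (\<integral>\<^sup>+y. f ((\<lambda>j\<in>I. 2 * c j)(i := 2 * y)) \<partial>half_unif) \<partial>half_cube I)
      = (\<integral>\<^sup>+c. (\<integral>\<^sup>+y. f (\<lambda>j\<in>insert i I. 2 * (c(i := y)) j) \<partial>half_unif) \<partial>half_cube I)"
    using insert.hyps by (intro nn_integral_cong arg_cong[where f=f]) (auto simp: fun_eq_iff)
  also have "\<dots> = (\<integral>\<^sup>+c. f (\<lambda>j\<in>insert i I. 2 * c j) \<partial>half_cube (insert i I))"
    using measurable_compose[OF dbl insert.prems] unfolding half_cube_def
    by (intro H.product_nn_integral_insert[OF insert.hyps, symmetric])
  finally show ?case unfolding card_insert_disjoint[OF insert.hyps] power_Suc by (simp only: mult_ac)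
qed

lemma AE_half_cube_bounds: "AE c in half_cube {..<d}. \<forall>i<d. 0 \<le> c i \<and> c i \<le> 1 / 2"
proof -
  have *: "AE c in half_cube {..<d}. 0 \<le> c i \<and> c i \<le> 1 / 2" if "i < d" for i
    unfolding half_cube_def
    by (rule AE_PiM_component[where P="\<lambda>y. 0 \<le> y \<and> y \<le> 1 / 2"])
       (use that in \<open>auto intro!: prob_space_half_unif AE_uniform_measureI\<close>)
  then have "AE c in half_cube {..<d}. \<forall>i\<in>{..<d}. 0 \<le> c i \<and> c i \<le> 1 / 2"
    by (intro eventually_ball_finite) auto
  then show ?thesis by eventually_elim auto
qed

text \<open>The doubling bound for the indicator of the ball: \<open>2 * c\<close> has norm at most
  \<open>r\<close> only if \<open>c\<close> has norm at most \<open>r / 2\<close>.\<close>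

lemma ball_vol_double:
  assumes "1 \<le> p" "1 \<le> d"
  shows "ball_vol p d r \<le> 2 ^ d * ball_vol p d (r / 2)"
proof -
  interpret prob_space "half_cube {..<d}" by (rule prob_space_half_cube)
  let ?B = "\<lambda>r. {c \<in> space (half_cube {..<d}). lp_norm p d c \<le> r}"
  have "emeasure (half_cube {..<d}) (?B r) = (\<integral>\<^sup>+c. indicator (?B r) c \<partial>half_cube {..<d})"
    by simp
  also have "\<dots> \<le> 2 ^ card {..<d} * (\<integral>\<^sup>+c. indicator (?B r) (\<lambda>i\<in>{..<d}. 2 * c i) \<partial>half_cube {..<d})"
    by (intro nn_integral_half_cube_double) auto
  also have "(\<integral>\<^sup>+c. indicator (?B r) (\<lambda>i\<in>{..<d}. 2 * c i) \<partial>half_cube {..<d})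
      \<le> (\<integral>\<^sup>+c. indicator (?B (r / 2)) c \<partial>half_cube {..<d})"
  \<comment> \<open>Only almost everywhere, because pulling the factor 2 out of the norm uses
    nonnegative coordinates, while the product space contains all real ones.\<close>
  proof (rule nn_integral_mono_AE, use AE_half_cube_bounds[of d] AE_space in eventually_elim)
    fix c assume c: "\<forall>i<d. 0 \<le> c i \<and> c i \<le> 1 / 2" "c \<in> space (half_cube {..<d})"
    have "lp_norm p d (\<lambda>i\<in>{..<d}. 2 * c i) = lp_norm p d (\<lambda>i. 2 * c i)"
      by (rule lp_norm_cong) simp
    also have "\<dots> = 2 * lp_norm p d c"
      using c assms by (intro lp_norm_scale) auto
    finally show "indicator (?B r) (\<lambda>i\<in>{..<d}. 2 * c i) \<le> (indicator (?B (r / 2)) c :: ennreal)"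
      using c by (auto simp: indicator_def)
  qed
  also have "\<dots> = emeasure (half_cube {..<d}) (?B (r / 2))" by simp
  finally have "ennreal (ball_vol p d r) \<le> 2 ^ d * ennreal (ball_vol p d (r / 2))"
    by (simp add: emeasure_eq_measure ball_vol_def mult_left_mono)
  also have "\<dots> = ennreal (2 ^ d * ball_vol p d (r / 2))"
    by (simp add: ennreal_mult'' ball_vol_def flip: ennreal_power ennreal_numeral)
  finally show ?thesis by (simp add: ball_vol_def)
qed

section \<open>Strict monotonicity of ball volumes\<close>

lemma lp_norm_const:
  assumes "1 \<le> p" "1 \<le> d" "0 \<le> u"
  shows "lp_norm p d (\<lambda>_. u) = u * lp_norm p d (\<lambda>_. 1)"
  using lp_norm_scale[of p d u "\<lambda>_. 1"] assms by simp

lemma lp_norm_one_pos: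
  assumes "1 \<le> p" "1 \<le> d"
  shows "0 < lp_norm p d (\<lambda>_. 1)"
proof -
  have "{..<d} \<noteq> {}" using \<open>1 \<le> d\<close> by (auto simp: lessThan_empty_iff)
  then show ?thesis using \<open>1 \<le> d\<close> by (auto simp: lp_norm_def)
qed

text \<open>For suitable \<open>l < h\<close>, vectors with all coordinates in \<open>{l..h}\<close>
  have norm above \<open>r\<close> and at most \<open>s\<close>, and they fill a box of positive
  volume. The bound on \<open>s\<close> keeps this box inside the cube of side 1/2.\<close>

lemma ball_vol_strict_mono:
  assumes p: "1 \<le> p" and d: "1 \<le> d" and r: "0 \<le> r" "r < s" "s \<le> lp_norm p d (\<lambda>_. 1 / 2)"
  shows "ball_vol p d r < ball_vol p d s"
proof -
  interpret prob_space "half_cube {..<d}" by (rule prob_space_half_cube)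
  interpret H: product_prob_space "\<lambda>_::nat. half_unif" "{..<d}"
    by (simp add: product_prob_spaceI prob_space_half_unif)
  define K where "K = lp_norm p d (\<lambda>_. 1)"
  have K: "0 < K" using lp_norm_one_pos[OF p d] by (simp add: K_def)
  have const: "lp_norm p d (\<lambda>_. u) = u * K" if "0 \<le> u" for u
    using lp_norm_const[OF p d that] by (simp add: K_def)
  \<comment> \<open>\<open>h\<close> is the coordinate of the constant vector of norm
    \<open>s\<close>, and \<open>l\<close> that of the constant vector of norm
    \<open>(r + s) / 2\<close>, which exceeds \<open>r\<close>.\<close>
  define l h where "l = (r + s) / (2 * K)" and "h = s / K"
  have lh: "0 \<le> l" "l < h" "h \<le> 1 / 2" "r < l * K" "h * K = s"
    using r K const[of "1/2"] by (auto simp: l_def h_def field_simps)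
  let ?B = "\<lambda>r. {c \<in> space (half_cube {..<d}). lp_norm p d c \<le> r}"
  let ?box = "\<Pi>\<^sub>E i\<in>{..<d}. {l..h}"
  have "measure half_unif {l..h} = 2 * (h - l)"
    using lh by (subst measure_uniform_measure) auto
  moreover have "measure (half_cube {..<d}) ?box = (\<Prod>i<d. measure half_unif {l..h})"
    using H.measure_PiM_emb[of "{..<d}" "\<lambda>_. {l..h}"] by (simp add: half_cube_def prod_emb_id)
  ultimately have box: "0 < measure (half_cube {..<d}) ?box" using lh by simp
  have box_sets: "?box \<in> sets (half_cube {..<d})"
    unfolding half_cube_def by (intro sets_PiM_I_finite) auto
  have box_bounds: "l \<le> c i \<and> 0 \<le> c i \<and> c i \<le> h" if "c \<in> ?box" "i < d" for c i
    using PiE_mem[OF that(1), of i] that(2) lh by simp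
  have "?B r \<inter> ?box = {}"
  proof -
    have "r < lp_norm p d c" if "c \<in> ?box" for c
    proof -
      have "l * K \<le> lp_norm p d c"
        unfolding const[OF lh(1), symmetric] using box_bounds[OF that] lh by (intro lp_norm_mono p d) auto
      with lh show ?thesis by simp
    qed
    then show ?thesis by (metis (no_types, lifting) disjoint_iff mem_Collect_eq not_le)
  qed
  then have "measure (half_cube {..<d}) (?B r \<union> ?box) = measure (half_cube {..<d}) (?B r) + measure (half_cube {..<d}) ?box"
    using box_sets by (intro finite_measure_Union) auto
  moreover have "?B r \<union> ?box \<subseteq> ?B s"
  proof -
    have "lp_norm p d c \<le> s" if "c \<in> ?box" for c
    proof -
      have "lp_norm p d c \<le> lp_norm p d (\<lambda>_. h)"
        using box_bounds[OF that] lh by (intro lp_norm_mono p d) auto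
      with lh const[of h] show ?thesis by simp
    qed
    then show ?thesis using r sets.sets_into_space[OF box_sets] by auto
  qed
  then have "measure (half_cube {..<d}) (?B r \<union> ?box) \<le> measure (half_cube {..<d}) (?B s)"
    by (intro finite_measure_mono) auto
  ultimately show ?thesis using box by (simp add: ball_vol_def)
qed

section \<open>Weights and adjacency\<close>

text \<open>The function is monotone and right-continuous with limits 0 and 1, so
  \<open>interval_measure\<close> has it as its distribution function.\<close>

lemma pareto_cdf_interval_measure:
  fixes \<beta> w0 :: real
  assumes w0: "0 < w0" and \<beta>: "1 < \<beta>"
  defines "F \<equiv> \<lambda>x. if x \<ge> w0 then 1 - (x / w0) powr (1 - \<beta>) else 0"
  shows "real_distribution (interval_measure F)" and "cdf (interval_measure F) = F"
proof -
  have mono: "F x \<le> F y" if "x \<le> y" for x y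
  proof (cases "w0 \<le> x")
    case True
    then have "(y / w0) powr (1 - \<beta>) \<le> (x / w0) powr (1 - \<beta>)"
      using that w0 \<beta> by (intro powr_mono2') (auto simp: divide_right_mono)
    then show ?thesis using True that by (simp add: F_def)
  next
    case False
    have "(y / w0) powr (1 - \<beta>) \<le> 1" if "w0 \<le> y"
      using powr_mono2'[of "1 - \<beta>" 1 "y / w0"] that w0 \<beta> by simp
    then show ?thesis using False by (simp add: F_def)
  qed
  have cont: "continuous (at_right a) F" for a
  proof (cases "w0 \<le> a")
    case True
    have "((\<lambda>x. 1 - (x / w0) powr (1 - \<beta>)) \<longlongrightarrow> 1 - (a / w0) powr (1 - \<beta>)) (at_right a)"
      using True w0 by (intro tendsto_intros) auto
    moreover have "\<forall>\<^sub>F x in at_right a. 1 - (x / w0) powr (1 - \<beta>) = F x"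
      using eventually_at_right_less[of a] by eventually_elim (use True in \<open>auto simp: F_def\<close>)
    ultimately have "(F \<longlongrightarrow> F a) (at_right a)"
      using True by (simp add: F_def Lim_transform_eventually)
    then show ?thesis by (simp add: continuous_within)
  next
    case False
    then have "\<forall>\<^sub>F x in at_right a. x < w0"
      by (intro order_tendstoD(2)[OF tendsto_ident_at]) auto
    then have "\<forall>\<^sub>F x in at_right a. 0 = F x" by eventually_elim (auto simp: F_def)
    then have "(F \<longlongrightarrow> 0) (at_right a)" using Lim_transform_eventually tendsto_const by blast
    then show ?thesis using False by (simp add: continuous_within F_def)
  qed
  have bot: "(F \<longlongrightarrow> 0) at_bot"
  proof -
    have "\<forall>\<^sub>F x in at_bot. 0 = F x"
      using eventually_gt_at_bot[of w0] by eventually_elim (auto simp: F_def)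
    then show ?thesis using Lim_transform_eventually tendsto_const by blast
  qed
  have top: "(F \<longlongrightarrow> 1) at_top"
  proof -
    have "filterlim (\<lambda>x. x / w0) at_top at_top"
      unfolding divide_inverse using w0
      by (intro filterlim_at_top_mult_tendsto_pos[OF tendsto_const _ filterlim_ident]) auto
    from tendsto_neg_powr[OF _ this, of "1 - \<beta>"] \<beta>
    have "((\<lambda>x. 1 - (x / w0) powr (1 - \<beta>)) \<longlongrightarrow> 1 - 0) at_top"
      by (intro tendsto_diff tendsto_const) auto
    moreover have "\<forall>\<^sub>F x in at_top. 1 - (x / w0) powr (1 - \<beta>) = F x"
      using eventually_ge_at_top[of w0] by eventually_elim (auto simp: F_def)
    ultimately show ?thesis by (simp add: Lim_transform_eventually)
  qed
  show "real_distribution (interval_measure F)"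
    by (rule real_distribution_interval_measure[OF mono cont bot top])
  show "cdf (interval_measure F) = F"
    by (rule cdf_interval_measure[OF mono cont bot])
qed

text \<open>The tail is the complement of the distribution function. At \<open>x = w0\<close> it
  equals 1, so restricting to \<open>{w0..}\<close> loses no mass.\<close>

lemma
  fixes \<beta> w0 :: real
  assumes w0: "0 < w0" and \<beta>: "1 < \<beta>"
  shows prob_space_weight_measure: "prob_space (weight_measure \<beta> w0)"
    and emeasure_weight_greater:
      "w0 \<le> x \<Longrightarrow> emeasure (weight_measure \<beta> w0) {x<..} = ennreal ((x / w0) powr (1 - \<beta>))"
proof -
  let ?F = "\<lambda>x. if x \<ge> w0 then 1 - (x / w0) powr (1 - \<beta>) else 0"
  let ?M = "interval_measure ?F"
  interpret real_distribution ?M by (rule pareto_cdf_interval_measure[OF assms])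
  have greater: "measure ?M {x<..} = (x / w0) powr (1 - \<beta>)" if "w0 \<le> x" for x
  proof -
    have "measure ?M {x<..} = 1 - cdf ?M x"
      unfolding cdf_def using prob_compl[of "{..x}"] by (simp add: Compl_eq_Diff_UNIV[symmetric])
    with that show ?thesis by (simp add: pareto_cdf_interval_measure(2)[OF assms])
  qed
  have "1 \<le> measure ?M {w0..}"
  proof -
    have "measure ?M {w0<..} \<le> measure ?M {w0..}" by (intro finite_measure_mono) auto
    then show ?thesis using greater[of w0] w0 by simp
  qed
  then have "measure ?M {w0..} = 1" using prob_le_1[of "{w0..}"] by linarith
  then have one: "emeasure ?M {w0..} = 1" by (simp add: emeasure_eq_measure)
  show "prob_space (weight_measure \<beta> w0)"
    by (rule prob_spaceI) (simp add: weight_measure_def emeasure_restrict_space space_restrict_space one)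
  show "emeasure (weight_measure \<beta> w0) {x<..} = ennreal ((x / w0) powr (1 - \<beta>))" if "w0 \<le> x"
    using that greater[OF that] unfolding weight_measure_def
    by (subst emeasure_restrict_space) (auto simp: emeasure_eq_measure)
qed

lemma space_weight_measure: "space (weight_measure \<beta> w0) = {w0..}"
  by (simp add: weight_measure_def space_restrict_space)

lemma weight_measurable: "(\<lambda>x. x) \<in> borel_measurable (weight_measure \<beta> w0)"
  unfolding weight_measure_def by (rule measurable_restrict_space1) (simp add: measurable_ident_sets)

section \<open>Ball volumes and connection thresholds\<close>

lemma ball_vol_mono: "r \<le> s \<Longrightarrow> ball_vol p d r \<le> ball_vol p d s"
proof -
  assume "r \<le> s"
  interpret prob_space "half_cube {..<d}" by (rule prob_space_half_cube)
  show ?thesis unfolding ball_vol_def using \<open>r \<le> s\<close> by (intro finite_measure_mono) auto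
qed

lemma ball_vol_le_1: "ball_vol p d r \<le> 1"
proof -
  interpret prob_space "half_cube {..<d}" by (rule prob_space_half_cube)
  show ?thesis unfolding ball_vol_def by simp
qed

lemma ball_vol_nonneg: "0 \<le> ball_vol p d r"
  by (simp add: ball_vol_def)

text \<open>Norms are nonnegative almost everywhere on the cube. The purpose is the converse
  direction: a threshold with positive connection probability is nonnegative.\<close>

lemma ball_vol_neg:
  assumes "1 \<le> d" "r < 0"
  shows "ball_vol p d r = 0"
proof -
  interpret prob_space "half_cube {..<d}" by (rule prob_space_half_cube)
  have "AE c in half_cube {..<d}. \<not> lp_norm p d c \<le> r"
    using AE_half_cube_bounds[of d]
  proof eventually_elim
    case (elim c)
    then have "0 \<le> lp_norm p d c" using \<open>1 \<le> d\<close> by (intro lp_norm_nonneg) auto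
    with \<open>r < 0\<close> show ?case by simp
  qed
  then have "AE c in half_cube {..<d}. c \<notin> {c \<in> space (half_cube {..<d}). lp_norm p d c \<le> r}"
    by eventually_elim auto
  then show ?thesis unfolding ball_vol_def by (subst prob_eq_0) auto
qed

text \<open>Places all distances in the range in which \<open>ball_vol_strict_mono\<close>
  applies.\<close>

lemma torus_dist_bounds:
  assumes "1 \<le> p" "1 \<le> d" "x \<in> space (torus_measure d)" "y \<in> space (torus_measure d)"
  shows "0 \<le> torus_dist p d x y" and "torus_dist p d x y \<le> lp_norm p d (\<lambda>_. 1 / 2)"
proof -
  have nonneg: "0 \<le> circle_dist (x i) (y i)" if "i < d" for i
    using assms that by (intro circle_dist_nonneg) (auto simp: space_torus_measure PiE_iff)
  then show "0 \<le> torus_dist p d x y"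
    unfolding torus_dist_eq_lp_norm using assms by (intro lp_norm_nonneg) auto
  show "torus_dist p d x y \<le> lp_norm p d (\<lambda>_. 1 / 2)"
    unfolding torus_dist_eq_lp_norm using assms nonneg circle_dist_le_half by (intro lp_norm_mono) auto
qed

text \<open>The triangle inequality on each circle feeds \<open>lp_norm_le_double\<close>. It makes
  two leaves of a star around \<open>x\<close> adjacent when \<open>r\<close> is half a
  threshold.\<close>

lemma torus_dist_le_double:
  assumes "1 \<le> p" "1 \<le> d"
    and xyz: "x \<in> space (torus_measure d)" "y \<in> space (torus_measure d)" "z \<in> space (torus_measure d)"
    and "torus_dist p d x y \<le> r" "torus_dist p d x z \<le> r"
  shows "torus_dist p d y z \<le> 2 * r"
  unfolding torus_dist_eq_lp_norm
proof (rule lp_norm_le_double[OF assms(1,2) _ _ assms(6,7)[unfolded torus_dist_eq_lp_norm]])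
  fix i assume "i < d"
  then have i: "x i \<in> {0..<1}" "y i \<in> {0..<1}" "z i \<in> {0..<1}"
    using xyz by (auto simp: space_torus_measure PiE_iff)
  then show "0 \<le> circle_dist (x i) (y i) \<and> 0 \<le> circle_dist (x i) (z i) \<and> 0 \<le> circle_dist (y i) (z i)"
    by (simp add: circle_dist_nonneg)
  show "circle_dist (y i) (z i) \<le> circle_dist (x i) (y i) + circle_dist (x i) (z i)"
    using circle_dist_triangle[OF i(2,1,3)] by (simp add: circle_dist_commute)
qed

lemma girg_threshold_iff:
  "girg_threshold lam n w0 d p t \<longleftrightarrow>
     (\<forall>a\<ge>w0. \<forall>b\<ge>w0. ball_vol p d (t a b) = min 1 (lam * a * b / real n))"
  by (simp add: girg_threshold_def prob_torus_dist_le)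

text \<open>Since the volume of a ball is strictly increasing in its radius, adjacency depends on
  the threshold only through the prescribed connection probability; in particular it is
  measurable although \<open>t\<close> need not be.\<close>

lemma torus_dist_le_threshold_iff:
  assumes "1 \<le> p" "1 \<le> d" "0 < lam" "0 < w0" "0 < n" and t: "girg_threshold lam n w0 d p t"
    and ab: "w0 \<le> a" "w0 \<le> b"
    and xy: "x \<in> space (torus_measure d)" "y \<in> space (torus_measure d)"
  shows "torus_dist p d x y \<le> t a b \<longleftrightarrow> ball_vol p d (torus_dist p d x y) \<le> min 1 (lam * a * b / real n)"
    (is "?D \<le> _ \<longleftrightarrow> _")
proof -
  have vol: "ball_vol p d (t a b) = min 1 (lam * a * b / real n)"
    using t ab by (simp add: girg_threshold_iff)
  have "0 < lam * a * b / real n" using assms by simp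
  \<comment> \<open>A negative threshold would give volume 0, whereas the connection probability is
    positive.\<close>
  then have "0 \<le> t a b" using vol ball_vol_neg[OF \<open>1 \<le> d\<close>, of "t a b" p] by (cases "t a b < 0") auto
  \<comment> \<open>A distance above the threshold has a strictly larger ball volume, hence one
    above the connection probability.\<close>
  then have "ball_vol p d (t a b) < ball_vol p d ?D" if "\<not> ?D \<le> t a b"
    using that torus_dist_bounds[OF assms(1,2) xy] assms by (intro ball_vol_strict_mono) auto
  then show ?thesis using ball_vol_mono[of ?D "t a b" p d] vol by fastforce
qed

section \<open>Cliques\<close>

lemma girg_component_measurable:
  assumes "v < n"
  shows "(\<lambda>\<omega>. fst (\<omega> v)) \<in> borel_measurable (girg_measure n \<beta> w0 d)"
    and "(\<lambda>\<omega>. snd (\<omega> v)) \<in> measurable (girg_measure n \<beta> w0 d) (torus_measure d)"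
proof -
  have v: "(\<lambda>\<omega>. \<omega> v) \<in> measurable (girg_measure n \<beta> w0 d) (weight_measure \<beta> w0 \<Otimes>\<^sub>M torus_measure d)"
    unfolding girg_measure_def using assms by (intro measurable_component_singleton) auto
  show "(\<lambda>\<omega>. fst (\<omega> v)) \<in> borel_measurable (girg_measure n \<beta> w0 d)"
    using measurable_compose[OF measurable_compose[OF v measurable_fst] weight_measurable] by simp
  show "(\<lambda>\<omega>. snd (\<omega> v)) \<in> measurable (girg_measure n \<beta> w0 d) (torus_measure d)"
    by (rule measurable_compose[OF v measurable_snd])
qed

lemma space_girg_component:
  assumes "\<omega> \<in> space (girg_measure n \<beta> w0 d)" "v < n"
  shows "w0 \<le> fst (\<omega> v)" and "snd (\<omega> v) \<in> space (torus_measure d)"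
proof -
  have "\<omega> v \<in> space (weight_measure \<beta> w0 \<Otimes>\<^sub>M torus_measure d)"
    using assms by (auto simp: girg_measure_def space_PiM PiE_iff)
  then show "w0 \<le> fst (\<omega> v)" "snd (\<omega> v) \<in> space (torus_measure d)"
    by (auto simp: space_pair_measure space_weight_measure)
qed

lemma girg_adj_iff_ball_vol:
  assumes "1 \<le> p" "1 \<le> d" "0 < lam" "0 < w0" and t: "girg_threshold lam n w0 d p t"
    and \<omega>: "\<omega> \<in> space (girg_measure n \<beta> w0 d)" and uv: "u < n" "v < n"
  shows "girg_adj d p t \<omega> u v \<longleftrightarrow> u \<noteq> v \<and>
    ball_vol p d (torus_dist p d (snd (\<omega> u)) (snd (\<omega> v))) \<le> min 1 (lam * fst (\<omega> u) * fst (\<omega> v) / real n)"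
  unfolding girg_adj_def
  using torus_dist_le_threshold_iff[OF assms(1-4) _ t space_girg_component(1)[OF \<omega> uv(1)]
      space_girg_component(1)[OF \<omega> uv(2)] space_girg_component(2)[OF \<omega> uv(1)]
      space_girg_component(2)[OF \<omega> uv(2)]] uv by simp

text \<open>Adjacency is rewritten by \<open>girg_adj_iff_ball_vol\<close> as a comparison of a ball
  volume with the connection probability. Both depend measurably on the outcome, and a clique is a
  finite conjunction of such comparisons.\<close>

lemma clique_event_measurable:
  assumes "1 \<le> p" "1 \<le> d" "0 < lam" "0 < w0" and t: "girg_threshold lam n w0 d p t" and S: "S \<subseteq> {..<n}"
  shows "{\<omega> \<in> space (girg_measure n \<beta> w0 d). is_clique (girg_adj d p t \<omega>) S} \<in> sets (girg_measure n \<beta> w0 d)"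
proof -
  let ?G = "girg_measure n \<beta> w0 d"
  let ?P = "\<lambda>\<omega> u v. ball_vol p d (torus_dist p d (snd (\<omega> u)) (snd (\<omega> v))) \<le> min 1 (lam * fst (\<omega> u) * fst (\<omega> v) / real n)"
  \<comment> \<open>Monotone functions are Borel measurable.\<close>
  have [measurable]: "ball_vol p d \<in> borel_measurable borel"
    by (intro borel_measurable_mono monoI ball_vol_mono)
  have "finite S" using S finite_subset by blast
  have "is_clique (girg_adj d p t \<omega>) S \<longleftrightarrow> (\<forall>u\<in>S. \<forall>v\<in>S. u \<noteq> v \<longrightarrow> ?P \<omega> u v)" if "\<omega> \<in> space ?G" for \<omega>
    unfolding is_clique_def using S girg_adj_iff_ball_vol[OF assms(1-5) that] by (metis lessThan_iff subsetD)
  then have eq: "{\<omega> \<in> space ?G. is_clique (girg_adj d p t \<omega>) S}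
      = {\<omega> \<in> space ?G. \<forall>u\<in>S. \<forall>v\<in>S. u \<noteq> v \<longrightarrow> ?P \<omega> u v}" by blast
  have pair: "{\<omega> \<in> space ?G. u \<noteq> v \<longrightarrow> ?P \<omega> u v} \<in> sets ?G" if "u \<in> S" "v \<in> S" for u v
  proof -
    have "u < n" "v < n" using S that by auto
    note [measurable] = girg_component_measurable[OF this(1), where ?\<beta> = \<beta> and ?w0.0 = w0 and d=d]
      girg_component_measurable[OF this(2), where ?\<beta> = \<beta> and ?w0.0 = w0 and d=d]
    have P: "{\<omega> \<in> space ?G. ?P \<omega> u v} \<in> sets ?G" by measurable
    show ?thesis
    proof (cases "u = v")
      case True
      then have "{\<omega> \<in> space ?G. u \<noteq> v \<longrightarrow> ?P \<omega> u v} = space ?G" by blast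
      then show ?thesis by (rule ssubst) (rule sets.top)
    next
      case False
      then have "{\<omega> \<in> space ?G. u \<noteq> v \<longrightarrow> ?P \<omega> u v} = {\<omega> \<in> space ?G. ?P \<omega> u v}" by blast
      then show ?thesis by (rule ssubst) (rule P)
    qed
  qed
  have "{\<omega> \<in> space ?G. \<forall>v\<in>S. u \<noteq> v \<longrightarrow> ?P \<omega> u v} \<in> sets ?G" if "u \<in> S" for u
    by (rule sets.sets_Collect_finite_All[where P="\<lambda>v \<omega>. u \<noteq> v \<longrightarrow> ?P \<omega> u v"])
       (use pair that \<open>finite S\<close> in blast)+
  then show ?thesis
    unfolding eq
    by (intro sets.sets_Collect_finite_All[where P="\<lambda>u \<omega>. \<forall>v\<in>S. u \<noteq> v \<longrightarrow> ?P \<omega> u v"] \<open>finite S\<close>)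
qed

section \<open>Lower bounds for clique probabilities\<close>

lemma prob_space_vertex_measure:
  "0 < w0 \<Longrightarrow> 1 < \<beta> \<Longrightarrow> prob_space (weight_measure \<beta> w0 \<Otimes>\<^sub>M torus_measure d)"
  by (intro prob_space_pair prob_space_weight_measure prob_space_torus_measure)

lemma prob_space_girg_measure: "0 < w0 \<Longrightarrow> 1 < \<beta> \<Longrightarrow> prob_space (girg_measure n \<beta> w0 d)"
  unfolding girg_measure_def by (intro prob_space_PiM prob_space_vertex_measure)

text \<open>By Fubini, \<open>clique_prob\<close> is the average over all \<open>S\<close> of the
  probability that the fixed set \<open>S\<close> is a clique, so a bound uniform in
  \<open>S\<close> carries over.\<close>

lemma clique_prob_ge:
  assumes "1 \<le> p" "1 \<le> d" "0 < lam" "0 < w0" "1 < \<beta>" "k \<le> n" and t: "girg_threshold lam n w0 d p t"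
    and ge: "\<And>S. S \<subseteq> {..<n} \<Longrightarrow> card S = k \<Longrightarrow>
      b \<le> \<P>(\<omega> in girg_measure n \<beta> w0 d. is_clique (girg_adj d p t \<omega>) S)"
  shows "b \<le> clique_prob n \<beta> w0 d p t k"
proof -
  let ?G = "girg_measure n \<beta> w0 d"
  let ?V = "{S. S \<subseteq> {..<n} \<and> card S = k}"
  let ?U = "uniform_count_measure ?V"
  let ?E = "\<lambda>S. {\<omega> \<in> space ?G. is_clique (girg_adj d p t \<omega>) S}"
  let ?A = "{z \<in> space (?G \<Otimes>\<^sub>M ?U). is_clique (girg_adj d p t (fst z)) (snd z)}"
  have fin: "finite ?V" by simp
  \<comment> \<open>Here \<open>k \<le> n\<close> enters: without a \<open>k\<close>-subset there
    would be no uniform distribution on them.\<close>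
  have "?V \<noteq> {}" using \<open>k \<le> n\<close> by (auto intro!: exI[of _ "{..<k}"])
  interpret G: prob_space ?G using assms by (intro prob_space_girg_measure)
  interpret U: prob_space ?U using fin \<open>?V \<noteq> {}\<close> by (rule prob_space_uniform_count_measure)
  interpret GU: pair_prob_space ?G ?U ..
  \<comment> \<open>There are finitely many \<open>S\<close>, so the event is a finite union of
    measurable rectangles.\<close>
  have "?A = (\<Union>S\<in>?V. ?E S \<times> {S})"
    by (auto simp: space_pair_measure space_uniform_count_measure)
  also have "\<dots> \<in> sets (?G \<Otimes>\<^sub>M ?U)"
    using fin clique_event_measurable[OF assms(1-4) t]
    by (intro sets.finite_UN pair_measureI) (auto simp: sets_uniform_count_measure)
  finally have A: "?A \<in> sets (?G \<Otimes>\<^sub>M ?U)" .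
  have "ennreal b = (\<integral>\<^sup>+S. ennreal b \<partial>?U)" by (simp add: U.emeasure_space_1)
  also have "\<dots> \<le> (\<integral>\<^sup>+S. emeasure ?G ((\<lambda>\<omega>. (\<omega>, S)) -` ?A) \<partial>?U)"
  proof (rule nn_integral_mono)
    fix S assume "S \<in> space ?U"
    then have S: "S \<subseteq> {..<n}" "card S = k" by (auto simp: space_uniform_count_measure)
    then have "(\<lambda>\<omega>. (\<omega>, S)) -` ?A = ?E S"
      by (auto simp: space_pair_measure space_uniform_count_measure)
    then show "ennreal b \<le> emeasure ?G ((\<lambda>\<omega>. (\<omega>, S)) -` ?A)"
      using ge[OF S] by (simp add: G.emeasure_eq_measure ennreal_leI)
  qed
  also have "\<dots> = emeasure (?G \<Otimes>\<^sub>M ?U) ?A" using GU.emeasure_pair_measure_alt2[OF A] ..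
  also have "\<dots> = ennreal (clique_prob n \<beta> w0 d p t k)"
    by (simp add: GU.emeasure_eq_measure clique_prob_def)
  finally show ?thesis by (simp add: clique_prob_def)
qed

text \<open>If both weights exceed \<open>x\<close>, the connection probability is 1, and adjacency
  only asks for a ball volume of at most 1, which always holds. The weights in \<open>S\<close> are
  independent, so their tail probabilities multiply.\<close>

lemma prob_heavy_clique:
  assumes "1 \<le> p" "1 \<le> d" "0 < lam" "0 < w0" "1 < \<beta>" and t: "girg_threshold lam n w0 d p t"
    and S: "S \<subseteq> {..<n}" and x: "w0 \<le> x" "real n \<le> lam * x\<^sup>2"
  shows "((x / w0) powr (1 - \<beta>)) ^ card S \<le> \<P>(\<omega> in girg_measure n \<beta> w0 d. is_clique (girg_adj d p t \<omega>) S)"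
proof -
  let ?G = "girg_measure n \<beta> w0 d"
  let ?M = "weight_measure \<beta> w0 \<Otimes>\<^sub>M torus_measure d"
  let ?X = "{x<..} \<times> space (torus_measure d)"
  interpret T: prob_space "torus_measure d" by (rule prob_space_torus_measure)
  interpret G: prob_space ?G using assms by (intro prob_space_girg_measure)
  interpret P: product_prob_space "\<lambda>_::nat. ?M" "{..<n}"
    using assms by (intro product_prob_spaceI prob_space_vertex_measure)
  have Wx: "{x<..} \<in> sets (weight_measure \<beta> w0)"
    using x by (auto simp: weight_measure_def sets_restrict_space_iff)
  have "{\<omega> \<in> space ?G. \<forall>v\<in>S. \<omega> v \<in> ?X} \<subseteq> {\<omega> \<in> space ?G. is_clique (girg_adj d p t \<omega>) S}"
  proof safe
    fix \<omega> assume \<omega>: "\<omega> \<in> space ?G" "\<forall>v\<in>S. \<omega> v \<in> ?X"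
    show "is_clique (girg_adj d p t \<omega>) S"
      unfolding is_clique_def
    proof (intro ballI impI)
      fix u v assume uv: "u \<in> S" "v \<in> S" "u \<noteq> v"
      then have n: "u < n" "v < n" using S by auto
      have "x \<le> fst (\<omega> u)" "x \<le> fst (\<omega> v)" using bspec[OF \<omega>(2) uv(1)] bspec[OF \<omega>(2) uv(2)] by (auto simp: mem_Times_iff)
      then have "x * x \<le> fst (\<omega> u) * fst (\<omega> v)" using x \<open>0 < w0\<close> by (intro mult_mono) auto
      then have "lam * x\<^sup>2 \<le> lam * (fst (\<omega> u) * fst (\<omega> v))"
        using \<open>0 < lam\<close> by (simp add: power2_eq_square)
      then have "1 \<le> lam * fst (\<omega> u) * fst (\<omega> v) / real n"
        using x n by (simp add: field_simps)
      then show "girg_adj d p t \<omega> u v"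
        using uv ball_vol_le_1 by (simp add: girg_adj_iff_ball_vol[OF assms(1-4) t \<omega>(1) n])
    qed
  qed
  then have "emeasure ?G {\<omega> \<in> space ?G. \<forall>v\<in>S. \<omega> v \<in> ?X} \<le> emeasure ?G {\<omega> \<in> space ?G. is_clique (girg_adj d p t \<omega>) S}"
    by (intro emeasure_mono clique_event_measurable[OF assms(1-4) t S])
  moreover have "emeasure ?G {\<omega> \<in> space ?G. \<forall>v\<in>S. \<omega> v \<in> ?X} = (\<Prod>v\<in>S. emeasure ?M ?X)"
    unfolding girg_measure_def using S Wx finite_subset[OF S]
    by (intro P.emeasure_PiM_Collect) auto
  moreover have "emeasure ?M ?X = ennreal ((x / w0) powr (1 - \<beta>))"
    using T.emeasure_pair_measure_Times[OF Wx sets.top] emeasure_weight_greater[OF assms(4,5) x(1)]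
    by (simp add: T.emeasure_space_1)
  ultimately show ?thesis by (simp add: G.emeasure_eq_measure ennreal_power)
qed

text \<open>Condition on the centre \<open>v0\<close>. The other positions are then independent, and
  each lies in the ball around the centre with a probability that does not depend on the centre. The
  centre itself is free, hence the exponent \<open>card S - 1\<close>.\<close>

lemma emeasure_star:
  assumes "0 < w0" "1 < \<beta>" and v0: "v0 \<in> S" and S: "S \<subseteq> {..<n}"
  shows "emeasure (girg_measure n \<beta> w0 d) {\<omega> \<in> space (girg_measure n \<beta> w0 d).
      \<forall>v\<in>S - {v0}. torus_dist p d (snd (\<omega> v0)) (snd (\<omega> v)) \<le> r} = ennreal (ball_vol p d r ^ (card S - 1))" (is "emeasure _ ?A = _")
proof -
  let ?G = "girg_measure n \<beta> w0 d"
  let ?W = "weight_measure \<beta> w0"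
  let ?M = "?W \<Otimes>\<^sub>M torus_measure d"
  let ?J = "{..<n} - {v0}"
  interpret T: prob_space "torus_measure d" by (rule prob_space_torus_measure)
  interpret W: prob_space ?W using assms by (intro prob_space_weight_measure)
  interpret M: prob_space ?M using assms by (intro prob_space_vertex_measure)
  interpret P: product_prob_space "\<lambda>_::nat. ?M" ?J
    using assms by (intro product_prob_spaceI prob_space_vertex_measure)
  have "finite S" using S finite_subset by blast
  have J: "{..<n} = insert v0 ?J" "finite ?J" "v0 \<notin> ?J" using v0 S by auto
  have A: "?A \<in> sets ?G"
  proof (intro sets.sets_Collect_finite_All finite_Diff \<open>finite S\<close>)
    fix v assume "v \<in> S - {v0}"
    then have "v0 < n" "v < n" using S v0 by auto
    note [measurable] = girg_component_measurable(2)[OF this(1), where ?\<beta> = \<beta> and ?w0.0 = w0 and d=d]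
      girg_component_measurable(2)[OF this(2), where ?\<beta> = \<beta> and ?w0.0 = w0 and d=d]
    show "{\<omega> \<in> space ?G. torus_dist p d (snd (\<omega> v0)) (snd (\<omega> v)) \<le> r} \<in> sets ?G" by measurable
  qed
  have "emeasure ?G ?A = (\<integral>\<^sup>+\<omega>. indicator ?A \<omega> \<partial>Pi\<^sub>M (insert v0 ?J) (\<lambda>_. ?M))"
    using A J(1) by (simp add: girg_measure_def)
  also have "\<dots> = (\<integral>\<^sup>+z. (\<integral>\<^sup>+\<omega>. indicator ?A ((\<omega>)(v0 := z)) \<partial>Pi\<^sub>M ?J (\<lambda>_. ?M)) \<partial>?M)"
    using A J(1) by (intro P.product_nn_integral_insert_rev J(2,3)) (simp add: girg_measure_def)
  also have "\<dots> = (\<integral>\<^sup>+z. ennreal (ball_vol p d r ^ (card S - 1)) \<partial>?M)"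
  proof (rule nn_integral_cong)
    fix z assume z: "z \<in> space ?M"
    \<comment> \<open>The weight is unconstrained and contributes the factor 1.\<close>
    let ?B = "space ?W \<times> {y \<in> space (torus_measure d). torus_dist p d (snd z) y \<le> r}"
    have sz: "snd z \<in> space (torus_measure d)" using z by (auto simp: space_pair_measure)
    have By: "{y \<in> space (torus_measure d). torus_dist p d (snd z) y \<le> r} \<in> sets (torus_measure d)"
      using sz by measurable
    have "emeasure ?M ?B = ennreal (ball_vol p d r)"
      unfolding T.emeasure_pair_measure_Times[OF sets.top By] emeasure_torus_ball[OF sz]
      by (simp add: W.emeasure_space_1)
    then have prod: "(\<Prod>v\<in>S - {v0}. emeasure ?M ?B) = ennreal (ball_vol p d r ^ (card S - 1))"
      using v0 \<open>finite S\<close> by (simp add: card_Diff_singleton ball_vol_nonneg ennreal_power)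
    have "(\<integral>\<^sup>+\<omega>. indicator ?A ((\<omega>)(v0 := z)) \<partial>Pi\<^sub>M ?J (\<lambda>_. ?M))
        = (\<integral>\<^sup>+\<omega>. indicator {\<omega> \<in> space (Pi\<^sub>M ?J (\<lambda>_. ?M)). \<forall>v\<in>S - {v0}. \<omega> v \<in> ?B} \<omega> \<partial>Pi\<^sub>M ?J (\<lambda>_. ?M))"
    proof (rule nn_integral_cong)
      fix \<omega> assume \<omega>: "\<omega> \<in> space (Pi\<^sub>M ?J (\<lambda>_. ?M))"
      have "(\<omega>)(v0 := z) \<in> space ?G"
        using \<omega> z J(1) by (auto simp: girg_measure_def space_PiM PiE_iff extensional_def)
      moreover have "\<omega> v \<in> space ?M" if "v \<in> S - {v0}" for v
        using \<omega> that S by (auto simp: space_PiM PiE_iff)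
      then have "\<omega> v \<in> ?B \<longleftrightarrow> torus_dist p d (snd z) (snd (\<omega> v)) \<le> r" if "v \<in> S - {v0}" for v
        using that by (auto simp: space_pair_measure mem_Times_iff)
      ultimately show "(indicator ?A ((\<omega>)(v0 := z)) :: ennreal)
          = indicator {\<omega> \<in> space (Pi\<^sub>M ?J (\<lambda>_. ?M)). \<forall>v\<in>S - {v0}. \<omega> v \<in> ?B} \<omega>"
        using \<omega> by (simp add: indicator_def)
    qed
    also have "\<dots> = emeasure (Pi\<^sub>M ?J (\<lambda>_. ?M)) {\<omega> \<in> space (Pi\<^sub>M ?J (\<lambda>_. ?M)). \<forall>v\<in>S - {v0}. \<omega> v \<in> ?B}"
    proof (rule nn_integral_indicator, intro sets.sets_Collect_finite_All finite_Diff \<open>finite S\<close>)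
      fix v assume "v \<in> S - {v0}"
      then have [measurable]: "(\<lambda>\<omega>. \<omega> v) \<in> measurable (Pi\<^sub>M ?J (\<lambda>_. ?M)) ?M"
        using S by (intro measurable_component_singleton) auto
      have [measurable]: "?B \<in> sets ?M" using By by auto
      show "{\<omega> \<in> space (Pi\<^sub>M ?J (\<lambda>_. ?M)). \<omega> v \<in> ?B} \<in> sets (Pi\<^sub>M ?J (\<lambda>_. ?M))"
        by measurable
    qed
    also have "\<dots> = (\<Prod>v\<in>S - {v0}. emeasure ?M ?B)"
      using S \<open>finite S\<close> By by (intro P.emeasure_PiM_Collect) auto
    finally show "(\<integral>\<^sup>+\<omega>. indicator ?A ((\<omega>)(v0 := z)) \<partial>Pi\<^sub>M ?J (\<lambda>_. ?M)) = ennreal (ball_vol p d r ^ (card S - 1))"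
      using prod by simp
  qed
  also have "\<dots> = ennreal (ball_vol p d r ^ (card S - 1))" by (simp add: M.emeasure_space_1)
  finally show "emeasure ?G ?A = ennreal (ball_vol p d r ^ (card S - 1))" .
qed

lemma torus_dist_self:
  assumes "1 \<le> p" "1 \<le> d"
  shows "torus_dist p d x x = 0"
  unfolding torus_dist_eq_lp_norm using lp_norm_const[OF assms, of 0] by (simp add: circle_dist_def)

text \<open>If all of \<open>S\<close> lies within half of \<open>t w0 w0\<close> of
  \<open>v0\<close>, any two members are within \<open>t w0 w0\<close>. Then
  \<open>emeasure_star\<close> gives the probability of this event, and
  \<open>ball_vol_double\<close> bounds the volume of the halved ball.\<close>

lemma prob_star_clique:
  assumes "1 \<le> p" "1 \<le> d" "0 < lam" "0 < w0" "1 < \<beta>" and t: "girg_threshold lam n w0 d p t"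
    and S: "S \<subseteq> {..<n}" "S \<noteq> {}"
  shows "(min 1 (lam * w0 * w0 / real n) / 2 ^ d) ^ (card S - 1)
    \<le> \<P>(\<omega> in girg_measure n \<beta> w0 d. is_clique (girg_adj d p t \<omega>) S)"
proof -
  let ?G = "girg_measure n \<beta> w0 d"
  let ?r = "t w0 w0"
  interpret G: prob_space ?G using assms by (intro prob_space_girg_measure)
  obtain v0 where v0: "v0 \<in> S" using S by auto
  then have "0 < n" using S by auto
  have vol: "ball_vol p d ?r = min 1 (lam * w0 * w0 / real n)"
    using t by (simp add: girg_threshold_iff)
  have "0 < lam * w0 * w0 / real n" using assms \<open>0 < n\<close> by simp
  then have r: "0 \<le> ?r" using vol ball_vol_neg[OF \<open>1 \<le> d\<close>, of ?r p] by (cases "?r < 0") auto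
  let ?A = "{\<omega> \<in> space ?G. \<forall>v\<in>S - {v0}. torus_dist p d (snd (\<omega> v0)) (snd (\<omega> v)) \<le> ?r / 2}"
  have "?A \<subseteq> {\<omega> \<in> space ?G. is_clique (girg_adj d p t \<omega>) S}"
  proof safe
    fix \<omega> assume \<omega>: "\<omega> \<in> space ?G" "\<forall>v\<in>S - {v0}. torus_dist p d (snd (\<omega> v0)) (snd (\<omega> v)) \<le> ?r / 2"
    \<comment> \<open>The case \<open>v = v0\<close> rests on the radius being nonnegative.\<close>
    have near: "torus_dist p d (snd (\<omega> v0)) (snd (\<omega> v)) \<le> ?r / 2" if "v \<in> S" for v
      using \<omega>(2) that r torus_dist_self[OF assms(1,2)] by (cases "v = v0") auto
    show "is_clique (girg_adj d p t \<omega>) S"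
      unfolding is_clique_def
    proof (intro ballI impI)
      fix u v assume uv: "u \<in> S" "v \<in> S" "u \<noteq> v"
      then have n: "u < n" "v < n" "v0 < n" using S v0 by auto
      note w = space_girg_component(1)[OF \<omega>(1) n(1)] space_girg_component(1)[OF \<omega>(1) n(2)]
      have "torus_dist p d (snd (\<omega> u)) (snd (\<omega> v)) \<le> 2 * (?r / 2)"
        using space_girg_component(2)[OF \<omega>(1)] n near uv
        by (intro torus_dist_le_double[OF assms(1,2), of "snd (\<omega> v0)"]) auto
      \<comment> \<open>Volumes are compared instead of thresholds: where the connection probability
        is 1 the threshold is not determined by it and need not grow with the weights.\<close>
      then have "ball_vol p d (torus_dist p d (snd (\<omega> u)) (snd (\<omega> v))) \<le> ball_vol p d ?r"
        by (intro ball_vol_mono) simp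
      also have "\<dots> \<le> min 1 (lam * (fst (\<omega> u) * fst (\<omega> v)) / real n)"
        unfolding vol mult.assoc using w assms
        by (intro min.mono order.refl divide_right_mono mult_left_mono mult_mono) auto
      finally show "girg_adj d p t \<omega> u v"
        using uv by (simp add: girg_adj_iff_ball_vol[OF assms(1-4) t \<omega>(1) n(1,2)] mult.assoc)
    qed
  qed
  then have "emeasure ?G ?A \<le> emeasure ?G {\<omega> \<in> space ?G. is_clique (girg_adj d p t \<omega>) S}"
    by (intro emeasure_mono clique_event_measurable[OF assms(1-4) t S(1)])
  then have "ball_vol p d (?r / 2) ^ (card S - 1) \<le> \<P>(\<omega> in ?G. is_clique (girg_adj d p t \<omega>) S)"
    unfolding emeasure_star[OF assms(4,5) v0 S(1)] by (simp add: G.emeasure_eq_measure)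
  moreover have "(min 1 (lam * w0 * w0 / real n) / 2 ^ d) ^ (card S - 1) \<le> ball_vol p d (?r / 2) ^ (card S - 1)"
    using ball_vol_double[OF assms(1,2), of ?r] assms by (intro power_mono) (auto simp: vol field_simps)
  ultimately show ?thesis by linarith
qed

text \<open>The two cases are the bounds \<open>heavy\<close> and \<open>star\<close>. The constant
  \<open>c\<close> is fixed before \<open>p\<close>, \<open>n\<close>, \<open>d\<close>,
  \<open>k\<close> and \<open>t\<close>, so it depends only on \<open>lam\<close>, \<open>w0\<close>
  and \<open>\<beta>\<close>.\<close>

theorem corollary10:
  fixes lam w0 \<beta> :: real
  assumes "lam > 0" and "w0 > 0" and "\<beta> > 2"
  shows "\<exists>c>0. \<forall>(p::ereal) (n::nat) (d::nat) (k::nat) (t :: real \<Rightarrow> real \<Rightarrow> real).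
           1 \<le> p \<longrightarrow> 1 \<le> d \<longrightarrow> 1 \<le> k \<longrightarrow> k \<le> n \<longrightarrow> girg_threshold lam n w0 d p t \<longrightarrow>
           clique_prob n \<beta> w0 d p t k \<ge>
             (if real k > 2 / (3 - \<beta>) \<and> 2 < \<beta> \<and> \<beta> < 3
              then c ^ k * real n powr (real k / 2 * (1 - \<beta>))
              else c ^ k * 2 powr (- (real d * real k)) * real n powr (1 - real k))"
proof -
  \<comment> \<open>\<open>m\<close> is the least factor at least 1 with
    \<open>w0 * m \<ge> 1 / sqrt lam\<close>. \<open>q\<close> is such that vertices of minimal
    weight connect with probability at least \<open>q / n\<close>. \<open>c\<close> lies below the
    bases of both bounds and is at most 1.\<close>
  define m where "m = max 1 (1 / (sqrt lam * w0))"
  define q where "q = min 1 (lam * w0 * w0)"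
  define c where "c = min q (m powr (1 - \<beta>))"
  have m: "1 \<le> m" "1 / (sqrt lam * w0) \<le> m" by (simp_all add: m_def)
  have q: "0 < q" "q \<le> 1" using assms by (auto simp: q_def)
  have c: "0 < c" "c \<le> q" "c \<le> m powr (1 - \<beta>)" using q m by (auto simp: c_def)
  have heavy: "c ^ k * real n powr (real k / 2 * (1 - \<beta>)) \<le> clique_prob n \<beta> w0 d p t k"
    if "1 \<le> p" "1 \<le> d" "1 \<le> k" "k \<le> n" "girg_threshold lam n w0 d p t" for p n d k t
  proof (rule clique_prob_ge[OF that(1,2) assms(1,2) _ that(4,5)])
    fix S assume S: "S \<subseteq> {..<n}" "card S = k"
    have n: "1 \<le> real n" using that by simp
    \<comment> \<open>\<open>x \<ge> sqrt (n / lam)\<close>, so two vertices of weight at least \<open>x\<close> are surely adjacent\<close>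
    define x where "x = w0 * (m * sqrt n)"
    have "1 * 1 \<le> m * sqrt n" using m n by (intro mult_mono) auto
    then have x1: "w0 \<le> x" using assms by (simp add: x_def)
    have "1 \<le> sqrt lam * w0 * m" using m(2) assms by (simp add: field_simps)
    then have "1\<^sup>2 \<le> (sqrt lam * w0 * m)\<^sup>2" by (intro power_mono) auto
    then have "1 \<le> lam * (w0 * m)\<^sup>2" using assms by (simp add: power_mult_distrib mult.assoc)
    then have "real n * 1 \<le> real n * (lam * (w0 * m)\<^sup>2)" by (intro mult_left_mono) auto
    then have x2: "real n \<le> lam * x\<^sup>2" by (simp add: x_def power_mult_distrib mult_ac)
    \<comment> \<open>The factor \<open>w0\<close> of \<open>x\<close> cancels, and the square root
      halves the exponent of \<open>n\<close>.\<close>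
    have "(x / w0) powr (1 - \<beta>) = m powr (1 - \<beta>) * real n powr ((1 - \<beta>) / 2)"
      using assms m n by (simp add: x_def powr_mult powr_half_sqrt[symmetric] powr_powr)
    then have "((x / w0) powr (1 - \<beta>)) ^ k = (m powr (1 - \<beta>)) ^ k * real n powr (real k / 2 * (1 - \<beta>))"
      using n by (simp add: power_mult_distrib powr_power mult_ac)
    moreover have "c ^ k * real n powr (real k / 2 * (1 - \<beta>)) \<le> (m powr (1 - \<beta>)) ^ k * real n powr (real k / 2 * (1 - \<beta>))"
      using c by (intro mult_right_mono power_mono) auto
    moreover have "((x / w0) powr (1 - \<beta>)) ^ card S \<le> \<P>(\<omega> in girg_measure n \<beta> w0 d. is_clique (girg_adj d p t \<omega>) S)"
      using assms by (intro prob_heavy_clique[OF that(1,2) assms(1,2) _ that(5) S(1) x1 x2]) auto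
    ultimately show "c ^ k * real n powr (real k / 2 * (1 - \<beta>)) \<le> \<P>(\<omega> in girg_measure n \<beta> w0 d. is_clique (girg_adj d p t \<omega>) S)"
      using S(2) by simp
  qed (use assms in auto)
  have star: "c ^ k * 2 powr (- (real d * real k)) * real n powr (1 - real k) \<le> clique_prob n \<beta> w0 d p t k"
    if "1 \<le> p" "1 \<le> d" "1 \<le> k" "k \<le> n" "girg_threshold lam n w0 d p t" for p n d k t
  proof (rule clique_prob_ge[OF that(1,2) assms(1,2) _ that(4,5)])
    fix S assume S: "S \<subseteq> {..<n}" "card S = k"
    have n: "1 \<le> real n" using that by simp
    \<comment> \<open>A star has only \<open>k - 1\<close> leaves; since \<open>c \<le> 1\<close>,
      the power \<open>c ^ k\<close> of the claim is the smaller one.\<close>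
    have "c ^ k \<le> c ^ (k - 1)" using c q by (intro power_decreasing) auto
    also have "\<dots> \<le> q ^ (k - 1)" using c by (intro power_mono) auto
    finally have ck: "c ^ k \<le> q ^ (k - 1)" .
    \<comment> \<open>The halved radius costs \<open>2 ^ d\<close> per leaf, that is
      \<open>k - 1\<close> times; the exponent \<open>d * k\<close> of the claim is weaker.\<close>
    have "2 powr (- (real d * real k)) \<le> 2 powr (- (real d * real (k - 1)))"
      by (intro powr_mono) (auto intro: mult_left_mono)
    also have "\<dots> = 1 / (2 ^ d) ^ (k - 1)"
      by (simp add: powr_minus_divide powr_realpow flip: power_mult of_nat_mult)
    finally have dk: "2 powr (- (real d * real k)) \<le> 1 / (2 ^ d) ^ (k - 1)" .
    have nk: "real n powr (1 - real k) = 1 / real n ^ (k - 1)"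
    proof -
      \<comment> \<open>\<open>k \<ge> 1\<close> makes subtraction on the naturals agree with that
        on the reals.\<close>
      have "1 - real k = - real (k - 1)" using that(3) by simp
      then show ?thesis using n by (simp add: powr_minus_divide powr_realpow del: of_nat_diff)
    qed
    have "c ^ k * 2 powr (- (real d * real k)) * real n powr (1 - real k)
        \<le> q ^ (k - 1) * (1 / (2 ^ d) ^ (k - 1)) * (1 / real n ^ (k - 1))"
      unfolding nk using ck dk q by (intro mult_mono) auto
    also have "\<dots> = (q / real n / 2 ^ d) ^ (k - 1)" by (simp add: power_divide power_mult_distrib)
    also have "\<dots> \<le> (min 1 (lam * w0 * w0 / real n) / 2 ^ d) ^ (k - 1)"
    proof (intro power_mono divide_right_mono)
      \<comment> \<open>The bound by 1 follows from \<open>q \<le> 1 \<le> n\<close>, the other one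
        from \<open>q \<le> lam * w0 * w0\<close>.\<close>
      show "q / real n \<le> min 1 (lam * w0 * w0 / real n)"
        using n q by (auto simp: q_def min_le_iff_disj divide_right_mono)
    qed (use q in auto)
    also have "\<dots> \<le> \<P>(\<omega> in girg_measure n \<beta> w0 d. is_clique (girg_adj d p t \<omega>) S)"
      unfolding S(2)[symmetric] using assms S that(3)
      by (intro prob_star_clique[OF that(1,2) assms(1,2) _ that(5) S(1)]) auto
    finally show "c ^ k * 2 powr (- (real d * real k)) * real n powr (1 - real k)
        \<le> \<P>(\<omega> in girg_measure n \<beta> w0 d. is_clique (girg_adj d p t \<omega>) S)" .
  qed (use assms in auto)
  show ?thesis using c(1) heavy star by (intro exI[of _ c]) auto
qed

end
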